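(* Let $C_0$ and $C_1$ be bivariate copulas on $[0,1]\times[0,1]$ such that $C_0$ is NQD and $C_1$ is PQD. For $\alpha\in[0,1]$ put $C_\alpha(u,v)=(1-\alpha)C_0(u,v)+\alpha C_1(u,v)$ and $\mathcal{C}_\alpha(v)=\int_0^1\big(C_\alpha(u,v)-uv\big)\,du$. Suppose that the function $$(u,v)\mapsto \frac{uv-C_0(u,v)}{C_1(u,v)-C_0(u,v)},$$ considered at those points $(u,v)\in[0,1]\times[0,1]$ where $C_1(u,v)\neq C_0(u,v)$, is not constant (i.e. it takes at least two distinct values). Assume furthermore that there is a constant $\kappa\in[0,1]$ such that, for all $v\in(0,1)$, $\mathcal{C}_0(v)\ne\mathcal{C}_1(v)$ and $$\frac{\mathcal{C}_0(v)}{\mathcal{C}_0(v)-\mathcal{C}_1(v)}=\kappa .$$ Then there is a nonempty open interval of values $\alpha\in[0,1]$ such that, for each $\alpha$ in this interval, the copula $C_\alpha$ is neither NQD nor PQD, but it is either NQDE or PQDE.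
   Context: A (bivariate) copula is a function $C:[0,1]^2\to[0,1]$ that is the joint cumulative distribution function, restricted to $[0,1]^2$, of a pair of random variables each uniformly distributed on $[0,1]$. A copula $C$ is PQD (positively quadrant dependent) if $C(u,v)\ge uv$ for all $u,v\in[0,1]$, and NQD (negatively quadrant dependent) if $C(u,v)\le uv$ for all $u,v\in[0,1]$. For a copula $C$ put $\mathcal{C}(v)=\int_0^1\big(C(u,v)-uv\big)\,du$ for $v\in[0,1]$. The copula $C$ is PQDE (positively quadrant dependent in expectation) if $\mathcal{C}(v)\ge 0$ for all $v\in[0,1]$, and NQDE (negatively quadrant dependent in expectation) if $\mathcal{C}(v)\le 0$ for all $v\in[0,1]$. *)

theory Defs
  imports "HOL-Probability.Probability"
begin

text \<open>Copulas are total functions on the reals of which only the values on the unit square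
  matter; no condition is imposed elsewhere.\<close>

definition uniform_joint_cdf ::
  "'a measure \<Rightarrow> ('a \<Rightarrow> real) \<Rightarrow> ('a \<Rightarrow> real) \<Rightarrow> (real \<Rightarrow> real \<Rightarrow> real) \<Rightarrow> bool" where
  "uniform_joint_cdf M X Y C \<longleftrightarrow>
     prob_space M \<and>
     X \<in> borel_measurable M \<and> distr M borel X = uniform_measure lborel {0..1} \<and>
     Y \<in> borel_measurable M \<and> distr M borel Y = uniform_measure lborel {0..1} \<and>
     (\<forall>u\<in>{0..1}. \<forall>v\<in>{0..1}. C u v = measure M {\<omega> \<in> space M. X \<omega> \<le> u \<and> Y \<omega> \<le> v})"

text \<open>HOL cannot quantify over the type of the sample space inside a definition. Sample spaces over
  \<open>real \<times> real\<close> suffice, because a pair of random variables may be replaced by its law; see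
  \<open>copula_if_uniform_joint_cdf\<close> below.\<close>

definition copula :: "(real \<Rightarrow> real \<Rightarrow> real) \<Rightarrow> bool" where
  "copula C \<longleftrightarrow> (\<exists>(M :: (real \<times> real) measure) X Y. uniform_joint_cdf M X Y C)"

lemma copula_if_uniform_joint_cdf:
  fixes M :: "'a measure"
  assumes "uniform_joint_cdf M X Y C"
  shows "copula C"
proof -
  interpret prob_space M using assms by (simp add: uniform_joint_cdf_def)
  have [measurable]: "X \<in> borel_measurable M" "Y \<in> borel_measurable M"
    using assms by (simp_all add: uniform_joint_cdf_def)
  define Z where "Z = (\<lambda>\<omega>. (X \<omega>, Y \<omega>))"
  have Z[measurable]: "Z \<in> M \<rightarrow>\<^sub>M borel"
    unfolding Z_def borel_prod[symmetric] by measurable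
  have [measurable]: "(fst :: real \<times> real \<Rightarrow> real) \<in> borel_measurable borel"
      "(snd :: real \<times> real \<Rightarrow> real) \<in> borel_measurable borel"
    unfolding borel_prod[symmetric] by measurable
  have "measure (distr M borel Z) {\<omega> \<in> space (distr M borel Z). fst \<omega> \<le> u \<and> snd \<omega> \<le> v} =
      measure M {\<omega> \<in> space M. X \<omega> \<le> u \<and> Y \<omega> \<le> v}" for u v
  proof -
    have "{\<omega> \<in> space (distr M borel Z). fst \<omega> \<le> u \<and> snd \<omega> \<le> v} \<in> sets borel"
      by measurable
    moreover have "Z -` {\<omega> \<in> space (distr M borel Z). fst \<omega> \<le> u \<and> snd \<omega> \<le> v} \<inter> space M =
        {\<omega> \<in> space M. X \<omega> \<le> u \<and> Y \<omega> \<le> v}"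
      by (auto simp: Z_def)
    ultimately show ?thesis
      by (simp add: measure_distr)
  qed
  moreover have "distr (distr M borel Z) borel fst = distr M borel X"
      "distr (distr M borel Z) borel snd = distr M borel Y"
    by (simp_all add: distr_distr comp_def Z_def[symmetric]) (simp_all add: Z_def)
  ultimately have "uniform_joint_cdf (distr M borel Z) fst snd C"
    using assms by (auto simp: uniform_joint_cdf_def prob_space_distr)
  then show ?thesis
    unfolding copula_def by blast
qed

definition PQD :: "(real \<Rightarrow> real \<Rightarrow> real) \<Rightarrow> bool" where
  "PQD C \<longleftrightarrow> (\<forall>u\<in>{0..1}. \<forall>v\<in>{0..1}. C u v \<ge> u * v)"

definition NQD :: "(real \<Rightarrow> real \<Rightarrow> real) \<Rightarrow> bool" where
  "NQD C \<longleftrightarrow> (\<forall>u\<in>{0..1}. \<forall>v\<in>{0..1}. C u v \<le> u * v)"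

definition mean_excess :: "(real \<Rightarrow> real \<Rightarrow> real) \<Rightarrow> real \<Rightarrow> real" where
  "mean_excess C v = integral {0..1} (\<lambda>u. C u v - u * v)"

definition PQDE :: "(real \<Rightarrow> real \<Rightarrow> real) \<Rightarrow> bool" where
  "PQDE C \<longleftrightarrow> (\<forall>v\<in>{0..1}. mean_excess C v \<ge> 0)"

definition NQDE :: "(real \<Rightarrow> real \<Rightarrow> real) \<Rightarrow> bool" where
  "NQDE C \<longleftrightarrow> (\<forall>v\<in>{0..1}. mean_excess C v \<le> 0)"

definition copula_mix ::
  "(real \<Rightarrow> real \<Rightarrow> real) \<Rightarrow> (real \<Rightarrow> real \<Rightarrow> real) \<Rightarrow> real \<Rightarrow> real \<Rightarrow> real \<Rightarrow> real" where
  "copula_mix C0 C1 \<alpha> u v = (1 - \<alpha>) * C0 u v + \<alpha> * C1 u v"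

end

(* At a point with C1 u v \<noteq> C0 u v, the excess of the mixture over u v is (C1 - C0) (\<alpha> - f), where f is
   the given ratio. If f takes values p < q, every \<alpha> strictly between them makes the excess positive
   at one point and negative at another. Integrating in u, the mean excess of the mixture is
   (\<alpha> - \<kappa>) times the difference of the mean excesses of C1 and C0, which has constant sign. *)
theory Submission
  imports Defs
begin

text \<open>Pushing the sample space forward along \<open>(X, Y)\<close> turns the random variables
  into the two coordinates on the Borel plane. Any two copulas then share one sigma-algebra and one
  pair of random variables, so only their measures have to be mixed.\<close>

lemma copula_law:
  assumes "copula C"
  obtains L :: "(real \<times> real) measure"
  where "sets L = sets borel" "uniform_joint_cdf L fst snd C"
proof -
  obtain M :: "(real \<times> real) measure" and X Y where U: "uniform_joint_cdf M X Y C"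
    using assms unfolding copula_def by blast
  interpret prob_space M using U by (simp add: uniform_joint_cdf_def)
  have [measurable]: "X \<in> borel_measurable M" "Y \<in> borel_measurable M"
    using U by (simp_all add: uniform_joint_cdf_def)
  define Z where "Z = (\<lambda>\<omega>. (X \<omega>, Y \<omega>))"
  have Z [measurable]: "Z \<in> M \<rightarrow>\<^sub>M borel"
    unfolding Z_def borel_prod[symmetric] by measurable
  have [measurable]: "(fst :: real \<times> real \<Rightarrow> real) \<in> borel_measurable borel"
      "(snd :: real \<times> real \<Rightarrow> real) \<in> borel_measurable borel"
    unfolding borel_prod[symmetric] by measurable
  have "measure (distr M borel Z) {\<omega> \<in> space (distr M borel Z). fst \<omega> \<le> u \<and> snd \<omega> \<le> v} =
      measure M {\<omega> \<in> space M. X \<omega> \<le> u \<and> Y \<omega> \<le> v}" for u v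
  proof -
    have "{\<omega> \<in> space (distr M borel Z). fst \<omega> \<le> u \<and> snd \<omega> \<le> v} \<in> sets borel"
      by measurable
    moreover have "Z -` {\<omega> \<in> space (distr M borel Z). fst \<omega> \<le> u \<and> snd \<omega> \<le> v} \<inter> space M =
        {\<omega> \<in> space M. X \<omega> \<le> u \<and> Y \<omega> \<le> v}"
      by (auto simp: Z_def)
    ultimately show ?thesis
      by (simp add: measure_distr)
  qed
  moreover have "distr (distr M borel Z) borel fst = distr M borel X"
      "distr (distr M borel Z) borel snd = distr M borel Y"
    by (simp_all add: distr_distr comp_def Z_def[symmetric]) (simp_all add: Z_def)
  ultimately have "uniform_joint_cdf (distr M borel Z) fst snd C"
    using U by (auto simp: uniform_joint_cdf_def prob_space_distr)
  then show thesis
    using that[of "distr M borel Z"] by simp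
qed

text \<open>Toss a coin with success probability \<alpha> and sample a point from the law of
  \<open>C1\<close> on success, from that of \<open>C0\<close> otherwise. Under the resulting law
  the probability of each Borel set is the \<alpha>-mixture of its two probabilities.\<close>

lemma copula_copula_mix:
  assumes "copula C0" "copula C1" "\<alpha> \<in> {0..1}"
  shows "copula (copula_mix C0 C1 \<alpha>)"
proof -
  obtain L0 where L0: "sets L0 = sets borel" "uniform_joint_cdf L0 fst snd C0"
    using copula_law[OF assms(1)] by blast
  obtain L1 where L1: "sets L1 = sets borel" "uniform_joint_cdf L1 fst snd C1"
    using copula_law[OF assms(2)] by blast
  have space: "space L0 = UNIV" "space L1 = UNIV"
    using sets_eq_imp_space_eq[OF L0(1)] sets_eq_imp_space_eq[OF L1(1)] by simp_all
  interpret P0: prob_space L0 using L0 by (simp add: uniform_joint_cdf_def)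
  interpret P1: prob_space L1 using L1 by (simp add: uniform_joint_cdf_def)
  have fst_snd [measurable]: "(fst :: real \<times> real \<Rightarrow> real) \<in> borel_measurable borel"
      "(snd :: real \<times> real \<Rightarrow> real) \<in> borel_measurable borel"
    unfolding borel_prod[symmetric] by measurable
  define L where
    "L = measure_pmf (bernoulli_pmf \<alpha>) \<bind> (\<lambda>b. if b then L1 else L0)"
  \<comment> \<open>Every set of coin outcomes is measurable, so being a kernel only asks that both
    values be subprobability measures on the Borel sets.\<close>
  have K: "(\<lambda>b. if b then L1 else L0) \<in> measure_pmf (bernoulli_pmf \<alpha>) \<rightarrow>\<^sub>M subprob_algebra borel"
    using L0(1) L1(1) P0.subprob_space_axioms P1.subprob_space_axioms
    by (auto simp: space_subprob_algebra)
  have sets_L [simp, measurable_cong]: "sets L = sets borel"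
    unfolding L_def by (rule sets_bind) (auto simp: L0(1) L1(1))
  have space_L [simp]: "space L = UNIV"
    using sets_eq_imp_space_eq[OF sets_L] by simp
  interpret P: prob_space L
    unfolding L_def using K
    by (rule prob_space.prob_space_bind[OF measure_pmf.prob_space_axioms, rotated])
      (simp add: P0.prob_space_axioms P1.prob_space_axioms)
  have emeasure_L: "emeasure L A = ennreal (1 - \<alpha>) * emeasure L0 A + ennreal \<alpha> * emeasure L1 A"
    if "A \<in> sets borel" for A
  proof -
    have "emeasure L A =
        (\<integral>\<^sup>+ b. emeasure (if b then L1 else L0) A \<partial>measure_pmf (bernoulli_pmf \<alpha>))"
      unfolding L_def using K that by (intro emeasure_bind) auto
    also have "\<dots> = ennreal (1 - \<alpha>) * emeasure L0 A + ennreal \<alpha> * emeasure L1 A"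
      using assms(3) by (simp add: nn_integral_bernoulli_pmf mult.commute add.commute)
    finally show ?thesis .
  qed
  have measure_L: "measure L A = (1 - \<alpha>) * measure L0 A + \<alpha> * measure L1 A"
    if "A \<in> sets borel" for A
  proof -
    \<comment> \<open>The two weights are nonnegative, so both sides are images of nonnegative reals
      and \<open>ennreal\<close> can be cancelled.\<close>
    have "ennreal (measure L A) = ennreal ((1 - \<alpha>) * measure L0 A + \<alpha> * measure L1 A)"
      using emeasure_L[OF that] assms(3)
      by (simp add: P.emeasure_eq_measure P0.emeasure_eq_measure P1.emeasure_eq_measure
          ennreal_mult)
    then show ?thesis
      using assms(3) by (subst (asm) ennreal_inj) auto
  qed
  \<comment> \<open>A marginal common to \<open>L0\<close> and \<open>L1\<close> survives mixing
    because the weights sum to 1. It is used with the coordinates as \<open>f\<close> and the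
    uniform law as \<open>D\<close>.\<close>
  have marginal: "distr L borel f = D"
    if f [measurable]: "f \<in> borel_measurable borel" and "distr L0 borel f = D" "distr L1 borel f = D"
    for f and D :: "real measure"
  proof (rule measure_eqI)
    show "sets (distr L borel f) = sets D" using that by auto
    fix A assume "A \<in> sets (distr L borel f)"
    then have A [measurable]: "A \<in> sets borel" by simp
    have vimage: "f -` A \<in> sets borel"
      using measurable_sets[OF f A] by simp
    have m: "f \<in> borel_measurable L0" "f \<in> borel_measurable L1"
      by (simp_all add: f measurable_cong_sets[OF L0(1) refl] measurable_cong_sets[OF L1(1) refl])
    have "emeasure L0 (f -` A) = emeasure D A" "emeasure L1 (f -` A) = emeasure D A"
      using emeasure_distr[OF m(1) A] emeasure_distr[OF m(2) A] that space by auto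
    then have "emeasure (distr L borel f) A = (ennreal (1 - \<alpha>) + ennreal \<alpha>) * emeasure D A"
      using emeasure_L[OF vimage] by (simp add: emeasure_distr distrib_right)
    also have "ennreal (1 - \<alpha>) + ennreal \<alpha> = 1"
      using assms(3) by (simp flip: ennreal_plus)
    finally show "emeasure (distr L borel f) A = emeasure D A" by simp
  qed
  have "{\<omega> :: real \<times> real. fst \<omega> \<le> u \<and> snd \<omega> \<le> v} \<in> sets borel" for u v
    by measurable
  then have "uniform_joint_cdf L fst snd (copula_mix C0 C1 \<alpha>)"
    using L0 L1 marginal[OF fst_snd(1)] marginal[OF fst_snd(2)] P.prob_space_axioms space
    by (auto simp: uniform_joint_cdf_def measure_L copula_mix_def)
  then show ?thesis
    by (rule copula_if_uniform_joint_cdf)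
qed

lemma measure_uniform_le:
  assumes "Y \<in> borel_measurable M" "distr M borel Y = uniform_measure lborel {0..1::real}"
    and "v \<in> {0..1}"
  shows "measure M {\<omega> \<in> space M. Y \<omega> \<le> v} = v"
proof -
  have "measure M {\<omega> \<in> space M. Y \<omega> \<le> v} = measure (distr M borel Y) {..v}"
    using assms(1) by (subst measure_distr) (auto intro!: arg_cong[where f = "measure M"])
  also have "\<dots> = measure lborel ({0..1} \<inter> {..v}) / measure lborel {0..1::real}"
    unfolding assms(2) by (subst measure_uniform_measure) auto
  also have "{0..1} \<inter> {..v} = {0..v}"
    using assms(3) by auto
  finally show ?thesis
    using assms(3) by simp
qed

text \<open>All three come from the events behind \<open>C\<close>: {Y \<le> 0} has probability 0,
  {Y \<le> 1} has probability 1 and may be dropped almost everywhere, and the event for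
  \<open>u\<close> grows with \<open>u\<close>.\<close>

lemma
  assumes "copula C"
  shows copula_zero_right: "u \<in> {0..1} \<Longrightarrow> C u 0 = 0"
    and copula_one_right: "u \<in> {0..1} \<Longrightarrow> C u 1 = u"
    and copula_mono_left: "v \<in> {0..1} \<Longrightarrow> mono_on {0..1} (\<lambda>u. C u v)"
proof -
  obtain M :: "(real \<times> real) measure" and X Y where U: "uniform_joint_cdf M X Y C"
    using assms unfolding copula_def by blast
  interpret prob_space M using U by (simp add: uniform_joint_cdf_def)
  have [measurable]: "X \<in> borel_measurable M" "Y \<in> borel_measurable M"
    using U by (simp_all add: uniform_joint_cdf_def)
  have C: "C u v = prob {\<omega> \<in> space M. X \<omega> \<le> u \<and> Y \<omega> \<le> v}" if "u \<in> {0..1}" "v \<in> {0..1}" for u v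
    using U that by (simp add: uniform_joint_cdf_def)
  have X: "prob {\<omega> \<in> space M. X \<omega> \<le> u} = u" and Y: "prob {\<omega> \<in> space M. Y \<omega> \<le> u} = u"
    if "u \<in> {0..1}" for u
    using U that by (auto simp: uniform_joint_cdf_def intro!: measure_uniform_le)
  show "C u 0 = 0" if "u \<in> {0..1}"
  proof -
    have "C u 0 \<le> prob {\<omega> \<in> space M. Y \<omega> \<le> 0}"
      using that by (subst C) (auto intro!: finite_measure_mono)
    moreover have "C u 0 \<ge> 0" using that by (simp add: C)
    ultimately show ?thesis using Y[of 0] by simp
  qed
  show "C u 1 = u" if "u \<in> {0..1}"
  proof -
    have "AE \<omega> in M. Y \<omega> \<le> 1"
      using Y[of 1] by (subst prob_Collect_eq_1[symmetric]) auto
    then have "prob {\<omega> \<in> space M. X \<omega> \<le> u \<and> Y \<omega> \<le> 1} = prob {\<omega> \<in> space M. X \<omega> \<le> u}"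
      by (intro finite_measure_eq_AE) auto
    then show ?thesis using that by (simp add: C X)
  qed
  show "mono_on {0..1} (\<lambda>u. C u v)" if "v \<in> {0..1}"
    using that by (intro mono_onI) (auto simp: C intro!: finite_measure_mono)
qed

text \<open>Monotone functions on a compact interval are integrable. This justifies linearity and
  monotonicity of \<open>integral\<close>, which would be 0 by default on a non-integrable
  function.\<close>

lemma copula_excess_integrable:
  assumes "copula C" "v \<in> {0..1}"
  shows "(\<lambda>u. C u v - u * v) integrable_on {0..1}"
proof (rule Henstock_Kurzweil_Integration.integrable_diff)
  show "(\<lambda>u. C u v) integrable_on {0..1}"
    by (rule integrable_on_mono_on[OF copula_mono_left[OF assms]])
  show "(\<lambda>u. u * v) integrable_on {0..1}"
    by (intro integrable_continuous_interval continuous_intros)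
qed

text \<open>At both endpoints C(u,v) = uv for every u, so the integrand vanishes. This covers the
  two values of v about which the hypothesis on \<kappa> is silent.\<close>

lemma mean_excess_copula_boundary:
  assumes "copula C" "v = 0 \<or> v = 1"
  shows "mean_excess C v = 0"
proof -
  have "mean_excess C v = integral {0..1} (\<lambda>u :: real. 0 :: real)"
    unfolding mean_excess_def
    using assms by (intro Henstock_Kurzweil_Integration.integral_cong) (auto simp: copula_zero_right copula_one_right)
  then show ?thesis by simp
qed

text \<open>Since the weights sum to 1, uv is its own mixture, and the excess of the mixture is the
  mixture of the excesses.\<close>

lemma mean_excess_copula_mix:
  assumes "copula C0" "copula C1" "v \<in> {0..1}"
  shows "mean_excess (copula_mix C0 C1 \<alpha>) v = (1 - \<alpha>) * mean_excess C0 v + \<alpha> * mean_excess C1 v"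
proof -
  have "mean_excess (copula_mix C0 C1 \<alpha>) v =
      integral {0..1} (\<lambda>u. (1 - \<alpha>) * (C0 u v - u * v) + \<alpha> * (C1 u v - u * v))"
    unfolding mean_excess_def copula_mix_def
    by (intro Henstock_Kurzweil_Integration.integral_cong) (simp add: algebra_simps)
  also have "\<dots> = integral {0..1} (\<lambda>u. (1 - \<alpha>) * (C0 u v - u * v)) +
      integral {0..1} (\<lambda>u. \<alpha> * (C1 u v - u * v))"
    using assms copula_excess_integrable
    by (intro Henstock_Kurzweil_Integration.integral_add integrable_on_mult_right) auto
  finally show ?thesis
    by (simp add: mean_excess_def)
qed

lemma mean_excess_NQD_nonpos:
  assumes "copula C" "NQD C" "v \<in> {0..1}"
  shows "mean_excess C v \<le> 0"
proof -
  have "mean_excess C v \<le> integral {0..1} (\<lambda>u :: real. 0 :: real)"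
    unfolding mean_excess_def using assms copula_excess_integrable
    by (intro Henstock_Kurzweil_Integration.integral_le) (auto simp: NQD_def)
  then show ?thesis by simp
qed

lemma mean_excess_PQD_nonneg:
  assumes "copula C" "PQD C" "v \<in> {0..1}"
  shows "mean_excess C v \<ge> 0"
  unfolding mean_excess_def using assms copula_excess_integrable
  by (intro Henstock_Kurzweil_Integration.integral_nonneg) (auto simp: PQD_def)

theorem theorem3p2:
  fixes C0 C1 :: "real \<Rightarrow> real \<Rightarrow> real" and \<kappa> :: real
  assumes "copula C0" and "copula C1"
    and "NQD C0" and "PQD C1"
    and "\<not> (\<lambda>(u, v). (u * v - C0 u v) / (C1 u v - C0 u v)) constant_on
           {(u, v). u \<in> {0..1} \<and> v \<in> {0..1} \<and> C1 u v \<noteq> C0 u v}"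
    and "\<kappa> \<in> {0..1}"
    and "\<forall>v\<in>{0<..<1}. mean_excess C0 v \<noteq> mean_excess C1 v \<and>
           mean_excess C0 v / (mean_excess C0 v - mean_excess C1 v) = \<kappa>"
  shows "\<exists>a b. a < b \<and> {a<..<b} \<subseteq> {0..1} \<and>
           (\<forall>\<alpha>\<in>{a<..<b}. copula (copula_mix C0 C1 \<alpha>) \<and>
              \<not> NQD (copula_mix C0 C1 \<alpha>) \<and> \<not> PQD (copula_mix C0 C1 \<alpha>) \<and>
              (NQDE (copula_mix C0 C1 \<alpha>) \<or> PQDE (copula_mix C0 C1 \<alpha>)))"
proof -
  \<comment> \<open>\<open>f u v\<close> is the weight at which the mixture takes exactly the value
    uv at (u,v).\<close>
  define f where "f = (\<lambda>u v. (u * v - C0 u v) / (C1 u v - C0 u v))"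
  define S where "S = {(u, v). u \<in> {0..1} \<and> v \<in> {0..1} \<and> C1 u v \<noteq> C0 u v}"
  have S: "u \<in> {0..1}" "v \<in> {0..1}" "C0 u v < C1 u v" "C0 u v \<le> u * v" "u * v \<le> C1 u v"
    if "(u, v) \<in> S" for u v
    using that assms(3,4) unfolding S_def NQD_def PQD_def by fastforce+
  \<comment> \<open>The numerator lies between 0 and the positive denominator because C0 \<le> uv
    \<le> C1. This keeps the interval of weights inside the unit interval.\<close>
  have f01: "f u v \<in> {0..1}" if "(u, v) \<in> S" for u v
    using S[OF that] by (simp add: f_def divide_simps)
  have excess: "copula_mix C0 C1 \<alpha> u v - u * v = (C1 u v - C0 u v) * (\<alpha> - f u v)"
    if "(u, v) \<in> S" for \<alpha> u v
  proof -
    have "(C1 u v - C0 u v) * f u v = u * v - C0 u v"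
      using S(3)[OF that] by (simp add: f_def)
    then show ?thesis
      by (simp add: copula_mix_def algebra_simps)
  qed
  \<comment> \<open>Without a strictly ordered pair of values, all values on \<open>S\<close> would
    coincide. An empty \<open>S\<close> is excluded too, since every function is
    \<open>constant_on\<close> it.\<close>
  have "\<exists>x\<in>S. \<exists>y\<in>S. case_prod f x < case_prod f y"
  proof (rule ccontr)
    assume "\<not> ?thesis"
    then have "case_prod f x = case_prod f y" if "x \<in> S" "y \<in> S" for x y
      using that by (meson linorder_neqE_linordered_idom)
    then have "case_prod f constant_on S"
      unfolding constant_on_def by blast
    then show False
      using assms(5) unfolding f_def S_def by blast
  qed
  then obtain u v u' v' where uv: "(u, v) \<in> S" "(u', v') \<in> S" "f u v < f u' v'"
    by auto
  \<comment> \<open>Clearing the denominator in the hypothesis on \<kappa> expresses the mean excess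
    of \<open>C0\<close> through the difference; at w = 0 and w = 1 both mean excesses are 0.
    Substituting into the mixture leaves the factor \<alpha> - \<kappa>, the same for every
    w.\<close>
  have excess_\<kappa>: "mean_excess (copula_mix C0 C1 \<alpha>) w =
      (\<alpha> - \<kappa>) * (mean_excess C1 w - mean_excess C0 w)" if "w \<in> {0..1}" for \<alpha> w
  proof -
    have "mean_excess C0 w = \<kappa> * (mean_excess C0 w - mean_excess C1 w)"
    proof (cases "w \<in> {0<..<1}")
      case True
      then have "mean_excess C0 w - mean_excess C1 w \<noteq> 0"
          "mean_excess C0 w / (mean_excess C0 w - mean_excess C1 w) = \<kappa>"
        using assms(7) by auto
      then show ?thesis by (simp add: divide_eq_eq)
    next
      case False
      then have "w = 0 \<or> w = 1" using that by auto
      then show ?thesis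
        using mean_excess_copula_boundary assms(1,2) by simp
    qed
    then show ?thesis
      using mean_excess_copula_mix[OF assms(1,2) that, of \<alpha>] by (simp add: algebra_simps)
  qed
  have diff_nonneg: "mean_excess C1 w - mean_excess C0 w \<ge> 0" if "w \<in> {0..1}" for w
    using mean_excess_NQD_nonpos[OF assms(1,3) that] mean_excess_PQD_nonneg[OF assms(2,4) that]
    by simp
  show ?thesis
  \<comment> \<open>The first goal fixes the interval: its endpoints are the two distinct ratio
    values \<open>f u v\<close> and \<open>f u' v'\<close>.\<close>
  proof (intro exI conjI ballI)
    show "f u v < f u' v'" by (fact uv(3))
    show "{f u v<..<f u' v'} \<subseteq> {0..1}"
      using f01[OF uv(1)] f01[OF uv(2)] by auto
    fix \<alpha> assume \<alpha>: "\<alpha> \<in> {f u v<..<f u' v'}"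
    then have "\<alpha> \<in> {0..1}"
      using f01[OF uv(1)] f01[OF uv(2)] by auto
    then show "copula (copula_mix C0 C1 \<alpha>)"
      using copula_copula_mix assms(1,2) by blast
    \<comment> \<open>The point with the smaller ratio refutes NQD; the one with the larger ratio
      will refute PQD.\<close>
    have "copula_mix C0 C1 \<alpha> u v - u * v > 0"
      unfolding excess[OF uv(1)] using \<alpha> S(3)[OF uv(1)] by simp
    then show "\<not> NQD (copula_mix C0 C1 \<alpha>)"
      using S(1,2)[OF uv(1)] unfolding NQD_def by force
    have "copula_mix C0 C1 \<alpha> u' v' - u' * v' < 0"
      unfolding excess[OF uv(2)] using \<alpha> S(3)[OF uv(2)] by (simp add: mult_pos_neg)
    then show "\<not> PQD (copula_mix C0 C1 \<alpha>)"
      using S(1,2)[OF uv(2)] unfolding PQD_def by force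
    show "NQDE (copula_mix C0 C1 \<alpha>) \<or> PQDE (copula_mix C0 C1 \<alpha>)"
    \<comment> \<open>The sign of \<alpha> - \<kappa> settles all w at once, as the other factor is
      nonnegative by \<open>diff_nonneg\<close>.\<close>
    proof (cases "\<alpha> \<le> \<kappa>")
      case True
      then have "NQDE (copula_mix C0 C1 \<alpha>)"
        unfolding NQDE_def using diff_nonneg by (simp add: excess_\<kappa> mult_nonpos_nonneg)
      then show ?thesis ..
    next
      case False
      then have "PQDE (copula_mix C0 C1 \<alpha>)"
        unfolding PQDE_def using diff_nonneg by (simp add: excess_\<kappa>)
      then show ?thesis ..
    qed
  qed
qed

end
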